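(* Let $\mu$ be a positive rational number and $\alpha,\beta>-1$. For every integer $n\ge2$ put $$\Lambda_n:=\frac{\Gamma(\mu)\left[\Gamma(\mu)+(\alpha+\beta+2)B(1+\mu(n-2),\mu)\right]}{B(1+\mu(n-1),\mu)B(1+\mu(n-2),\mu)}.$$ Then the fractional differential equation (on $x>0$) $$(1-x^{2\mu})\left({}^CD_x^\mu\right)^2y(x)+\left[\beta-\alpha-(\alpha+\beta+2)x^\mu\right]{}^CD_x^\mu y(x)+\Lambda_n\,y(x)=0$$ has a solution which is a polynomial in $x^\mu$ of degree $n$, $$y_{J,m_\mu}(x)=\sum_{\nu=0}^na_\nu x^{\mu\nu},$$ where, for suitable initial values $a_0,a_1$, the sequence $(a_\nu)_{\nu\ge0}$ satisfies $$a_2=-\frac{(\beta-\alpha)\Gamma(1+\mu)}{\Gamma(1+2\mu)}a_1-\frac{\Lambda_n}{\Gamma(1+2\mu)}a_0,$$ $$a_3=\frac{\Gamma(1+\mu)\left(\Gamma(1+\mu)(\alpha+\beta+2)+(\beta-\alpha)^2-\Lambda_n\right)}{\Gamma(1+3\mu)}a_1+\frac{(\beta-\alpha)\Lambda_n}{\Gamma(1+3\mu)}a_0,$$ and, for $\nu\ge2$, $$a_{\nu+2}=\frac{B(1+\mu\nu,\mu)B(1+\mu(\nu+1),\mu)}{\Gamma(\mu)}\left(\frac{\Gamma(\mu)+(\alpha+\beta+2)B(1+\mu(\nu-2),\mu)}{B(1+\mu(\nu-1),\mu)B(1+\mu(\nu-2),\mu)}-\frac{\Gamma(\mu)+(\a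lpha+\beta+2)B(1+\mu(n-2),\mu)}{B(1+\mu(n-1),\mu)B(1+\mu(n-2),\mu)}\right)a_\nu-\frac{B(1+\mu(\nu+1),\mu)(\beta-\alpha)}{\Gamma(\mu)}a_{\nu+1}.$$
   Context: $\Gamma$ is the Gamma function and $B(\cdot,\cdot)$ the beta function, $B(a,b)=\Gamma(a)\Gamma(b)/\Gamma(a+b)$. ${}^CD_x^\mu$ is the Caputo fractional derivative with base point $0$: for $x>0$, ${}^CD_x^\mu f(x)=\frac{1}{\Gamma(N-\mu)}\int_0^x\frac{f^{(N)}(\tau)}{(x-\tau)^{\mu+1-N}}\,d\tau$ if $N-1<\mu<N\in\mathbb{N}$, and ${}^CD_x^Nf=\frac{d^N}{dx^N}f$ if $\mu=N\in\mathbb{N}$. $({}^CD_x^\mu)^2$ means ${}^CD_x^\mu$ applied twice. *)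

theory Defs
  imports "HOL-Analysis.Analysis"
begin

text \<open>
  Caputo fractional derivative of order \<open>\<mu> > 0\<close> with base point \<open>0\<close>, meaningful for \<open>x > 0\<close>.
  With \<open>N = \<lceil>\<mu>\<rceil>\<close> either \<open>N - 1 < \<mu> < N\<close> or \<open>\<mu> = N\<close>. Only values of \<open>f\<close> at positive
  arguments matter, so the operator can be iterated although its result is unspecified
  for \<open>x \<le> 0\<close>.
\<close>

definition caputo_integrand :: "real \<Rightarrow> (real \<Rightarrow> real) \<Rightarrow> real \<Rightarrow> real \<Rightarrow> real" where
  "caputo_integrand \<mu> f x \<tau> =
     (deriv ^^ nat \<lceil>\<mu>\<rceil>) f \<tau> / (x - \<tau>) powr (\<mu> + 1 - real (nat \<lceil>\<mu>\<rceil>))"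

definition caputo :: "real \<Rightarrow> (real \<Rightarrow> real) \<Rightarrow> real \<Rightarrow> real" where
  "caputo \<mu> f x =
     (if \<mu> = real (nat \<lceil>\<mu>\<rceil>) then (deriv ^^ nat \<lceil>\<mu>\<rceil>) f x
      else 1 / Gamma (real (nat \<lceil>\<mu>\<rceil>) - \<mu>) * (LBINT \<tau>:{0<..<x}. caputo_integrand \<mu> f x \<tau>))"

text \<open>
  Since \<open>deriv\<close> and the Lebesgue integral are total functions in HOL, the existence of the
  derivatives and of the integral on the whole half line has to be required separately.
\<close>

definition caputo_differentiable :: "real \<Rightarrow> (real \<Rightarrow> real) \<Rightarrow> bool" where
  "caputo_differentiable \<mu> f \<longleftrightarrow>
     (\<forall>k < nat \<lceil>\<mu>\<rceil>. \<forall>x > 0. (deriv ^^ k) f differentiable (at x)) \<and>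
     (\<mu> \<noteq> real (nat \<lceil>\<mu>\<rceil>) \<longrightarrow>
        (\<forall>x > 0. set_integrable lborel {0<..<x} (caputo_integrand \<mu> f x)))"

lemma caputo_nonint:
  assumes "real N - 1 < \<mu>" and "\<mu> < real N"
  shows "caputo \<mu> f x = 1 / Gamma (real N - \<mu>) *
           (LBINT \<tau>:{0<..<x}. (deriv ^^ N) f \<tau> / (x - \<tau>) powr (\<mu> + 1 - real N))"
proof -
  have "\<lceil>\<mu>\<rceil> = int N"
    using assms by (intro ceiling_unique) auto
  then show ?thesis
    using assms by (simp add: caputo_def caputo_integrand_def [abs_def])
qed

lemma caputo_of_nat: "caputo (real N) f x = (deriv ^^ N) f x"
  by (simp add: caputo_def)

definition jacobi_Lambda :: "real \<Rightarrow> real \<Rightarrow> real \<Rightarrow> nat \<Rightarrow> real" where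
  "jacobi_Lambda \<mu> \<alpha> \<beta> n =
     Gamma \<mu> * (Gamma \<mu> + (\<alpha> + \<beta> + 2) * Beta (1 + \<mu> * (real n - 2)) \<mu>) /
     (Beta (1 + \<mu> * (real n - 1)) \<mu> * Beta (1 + \<mu> * (real n - 2)) \<mu>)"

end

(* The Caputo derivative lowers a power x^(mu k) to c_k x^(mu (k - 1)), where c_0 = 0 and
   c_k = Gamma(1 + mu k) / Gamma(1 + mu (k - 1)). In the variable X = x^mu the differential operator
   therefore maps polynomials of degree at most n to themselves, and with respect to the monomials
   it is upper triangular with diagonal entries Lambda_n - c_k (c_{k-1} + alpha + beta + 2), where
   Lambda_n = c_n (c_{n-1} + alpha + beta + 2). Strict log-convexity of Gamma makes c_k strictly
   increasing, so only the entry k = n vanishes and the coefficients are found by backward recursion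
   from a_n = 1. Continued by zero, they satisfy the forward recursion for all indices, since its
   factor at index n is zero. *)
theory Submission
  imports Defs
begin

section \<open>Caputo derivatives of sums of powers\<close>

text \<open>The value at 0 is set apart because the Caputo derivative annihilates constants, whereas
  the Gamma quotient at \<open>k = 0\<close> is the Riemann-Liouville value
  \<open>1 / Gamma (1 - \<mu>)\<close>, nonzero for non-integer \<mu>.\<close>

definition caputo_coeff :: "real \<Rightarrow> nat \<Rightarrow> real" where
  "caputo_coeff \<mu> k = (if k = 0 then 0 else Gamma (1 + \<mu> * real k) / Gamma (1 + \<mu> * (real k - 1)))"

text \<open>Knowing \<open>f\<close> on the open half line suffices, since derivatives depend only
  on values nearby. This makes the lemma applicable to a function that is itself a Caputo
  derivative.\<close>

lemma higher_deriv_powr_sum: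
  fixes f :: "real \<Rightarrow> real"
  assumes "\<And>x. x > 0 \<Longrightarrow> f x = (\<Sum>k\<le>m. b k * x powr p k)" and "x > 0"
  shows "(deriv ^^ j) f x = (\<Sum>k\<le>m. b k * (\<Prod>i<j. p k - real i) * x powr (p k - real j))"
    and "(deriv ^^ j) f differentiable at x"
proof -
  define h where "h j x = (\<Sum>k\<le>m. b k * (\<Prod>i<j. p k - real i) * x powr (p k - real j))"
    for j and x :: real
  have h: "(h j has_real_derivative h (Suc j) x) (at x)" if "x > 0" for x j
    unfolding h_def using that
    by (auto intro!: derivative_eq_intros sum.cong simp: algebra_simps)
  have near: "\<forall>\<^sub>F z in nhds x. g z = h j z" if "x > 0" "\<And>z. z > 0 \<Longrightarrow> g z = h j z" for x g j
    using eventually_nhds_in_open[of "{0<..}" x] that by (auto elim: eventually_mono)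
  have eq: "(deriv ^^ j) f x = h j x" if "x > 0" for x j
    using that
  proof (induction j arbitrary: x)
    case 0
    then show ?case using assms(1) by (simp add: h_def)
  next
    case (Suc j)
    have "deriv ((deriv ^^ j) f) x = deriv (h j) x"
      by (rule deriv_cong_ev[OF near[OF Suc.prems Suc.IH] refl])
    then show ?case
      using h[OF Suc.prems] by (simp add: DERIV_imp_deriv)
  qed
  show "(deriv ^^ j) f x = (\<Sum>k\<le>m. b k * (\<Prod>i<j. p k - real i) * x powr (p k - real j))"
    using eq[OF assms(2)] by (simp add: h_def)
  have "((deriv ^^ j) f has_real_derivative h (Suc j) x) (at x)"
    by (rule DERIV_cong_ev[THEN iffD2, OF refl _ refl h[OF assms(2), of j]])
       (intro near eq assms(2))
  then show "(deriv ^^ j) f differentiable at x"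
    by (auto simp: real_differentiable_def)
qed

text \<open>The functional equation of Gamma telescopes; the bound on \<open>N\<close> keeps every
  argument positive, away from the poles.\<close>

lemma falling_factorial_Gamma:
  fixes p :: real
  assumes "real N < p + 1"
  shows "(\<Prod>i<N. p - real i) = Gamma (p + 1) / Gamma (p + 1 - real N)"
  using assms
proof (induction N)
  case 0
  then show ?case by (simp add: less_imp_neq[OF Gamma_real_pos, symmetric])
next
  case (Suc N)
  have "Gamma (p - real N + 1) = (p - real N) * Gamma (p - real N)"
    using Suc.prems by (intro Gamma_plus1) (auto elim!: nonpos_Ints_cases)
  then have "Gamma (p + 1 - real N) = (p - real N) * Gamma (p - real N)"
    by (simp add: algebra_simps)
  then show ?case
    using Suc by simp
qed

text \<open>The substitution \<open>t = x * u\<close> turns this into the Beta integral. The Bochner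
  form delivers integrability and value together; \<open>caputo_differentiable\<close> needs the
  first, \<open>caputo\<close> the second.\<close>

lemma has_bochner_integral_Beta_scaled:
  fixes p q x :: real
  assumes "p > 0" "q > 0" "x > 0"
  shows "has_bochner_integral lborel
           (\<lambda>t. indicator {0<..<x} t * (t powr (p - 1) * (x - t) powr (q - 1)))
           (x powr (p + q - 1) * Beta p q)"
proof -
  define f where "f t = indicator {0..1} t * (t powr (p - 1) * (1 - t) powr (q - 1))" for t :: real
  have int: "set_integrable lborel {0..1} (\<lambda>t. t powr (p - 1) * (1 - t) powr (q - 1))"
    using integrable_Beta[of p q] assms by simp
  have "(LBINT t:{0..1}. t powr (p - 1) * (1 - t) powr (q - 1)) = Beta p q"
    using has_integral_Beta_real[of p q] assms set_borel_integral_eq_integral(2)[OF int]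
    by (simp add: integral_unique)
  then have "has_bochner_integral lborel f (Beta p q)"
    using int unfolding f_def set_integrable_def set_lebesgue_integral_def
    by (simp add: has_bochner_integral_iff)
  then have "has_bochner_integral lborel (\<lambda>t. f (0 + inverse x * t)) (Beta p q /\<^sub>R \<bar>inverse x\<bar>)"
    using assms by (subst (asm) lborel_has_bochner_integral_real_affine_iff[of "inverse x" _ _ 0]) auto
  \<comment> \<open>The power of \<open>x\<close> undoes the scaling of both factors of the
    integrand; the further factor \<open>x\<close> in the value is the Jacobian.\<close>
  then have "has_bochner_integral lborel (\<lambda>t. x powr (p + q - 2) * f (inverse x * t))
               (x powr (p + q - 2) * (x * Beta p q))"
    using assms by (intro has_bochner_integral_mult_right) (auto simp: mult.commute)
  moreover have "x powr (p + q - 2) * f (inverse x * t)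
      = indicator {0<..<x} t * (t powr (p - 1) * (x - t) powr (q - 1))" for t
  proof (cases "t \<in> {0<..<x}")
    case True
    then have "1 - inverse x * t = (x - t) / x"
      using assms by (simp add: field_simps)
    moreover have "x powr (p + q - 2) = x powr (p - 1) * x powr (q - 1)"
      by (simp flip: powr_add)
    ultimately show ?thesis
      using True assms by (simp add: f_def powr_divide powr_mult field_simps inverse_powr)
  next
    case False
    have "f (inverse x * t) = 0"
    \<comment> \<open>Closed and open interval agree even at the endpoints, because
      \<open>powr\<close> with base 0 is 0.\<close>
    proof (cases "t = 0 \<or> t = x")
      case True
      then show ?thesis using assms by (auto simp: f_def)
    next
      case nt: False
      then have "inverse x * t \<notin> {0..1}"
        using assms False by (auto simp: field_simps zero_le_mult_iff)
      then show ?thesis by (simp add: f_def)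
    qed
    then show ?thesis using False by simp
  qed
  moreover have "x powr (p + q - 2) * (x * Beta p q) = x powr (p + q - 1) * Beta p q"
    using assms powr_add[of x "p + q - 2" 1] by simp
  ultimately show ?thesis by simp
qed

text \<open>Differentiating N times yields a falling factorial, and the fractional integral yields a
  Beta value; their Gamma factors cancel to \<open>caputo_coeff\<close>. For integer \<mu> the
  falling factorial already is \<open>caputo_coeff\<close>.\<close>

lemma caputo_powr_sum:
  fixes f :: "real \<Rightarrow> real"
  assumes "\<mu> > 0" and f: "\<And>x. x > 0 \<Longrightarrow> f x = (\<Sum>k\<le>m. b k * x powr (\<mu> * real k))"
  shows "caputo_differentiable \<mu> f"
    and "x > 0 \<Longrightarrow> caputo \<mu> f x = (\<Sum>k\<le>m. b k * caputo_coeff \<mu> k * x powr (\<mu> * (real k - 1)))"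
proof -
  define N where "N = nat \<lceil>\<mu>\<rceil>"
  have N: "N > 0" "\<mu> \<le> real N" "real N < \<mu> + 1"
    using \<open>\<mu> > 0\<close> unfolding N_def by linarith+
  define P where "P k = (\<Prod>i<N. \<mu> * real k - real i)" for k
  \<comment> \<open>The constant term drops out before integration. This matters, since its power
    \<open>t powr (- real N)\<close> is not integrable at 0, while \<open>big\<close> makes the
    powers for \<open>k > 0\<close> integrable there.\<close>
  have P0: "P 0 = 0"
    using N by (auto simp: P_def)
  have big: "\<mu> * real k + 1 - real N > 0" if "k > 0" for k
  proof -
    have "\<mu> * 1 \<le> \<mu> * real k"
      using that \<open>\<mu> > 0\<close> by (intro mult_left_mono) auto
    then show ?thesis using N by linarith
  qed
  have P: "P k = Gamma (\<mu> * real k + 1) / Gamma (\<mu> * real k + 1 - real N)" if "k > 0" for k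
    unfolding P_def using big[OF that] by (intro falling_factorial_Gamma) simp
  note D = higher_deriv_powr_sum[OF f]
  have DN: "(deriv ^^ N) f t = (\<Sum>k\<le>m. b k * P k * t powr (\<mu> * real k - real N))" if "t > 0" for t
    using D(1)[OF _ that] by (simp add: P_def)
  have frac: "has_bochner_integral lborel (\<lambda>t. indicator {0<..<x} t *\<^sub>R caputo_integrand \<mu> f x t)
      (Gamma (real N - \<mu>) * (\<Sum>k\<le>m. b k * caputo_coeff \<mu> k * x powr (\<mu> * (real k - 1))))"
    if "\<mu> \<noteq> real N" "x > 0" for x
  proof -
    have *: "has_bochner_integral lborel
       (\<lambda>t. b k * P k * (indicator {0<..<x} t *
          (t powr (\<mu> * real k - real N) * (x - t) powr (real N - \<mu> - 1))))
       (Gamma (real N - \<mu>) * (b k * caputo_coeff \<mu> k * x powr (\<mu> * (real k - 1))))" for k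
    proof (cases "k = 0")
      case True
      then show ?thesis by (simp add: P0 caputo_coeff_def has_bochner_integral_zero)
    next
      case False
      have "has_bochner_integral lborel
       (\<lambda>t. b k * P k * (indicator {0<..<x} t *
          (t powr (\<mu> * real k - real N) * (x - t) powr (real N - \<mu> - 1))))
       (b k * P k * (x powr (\<mu> * real k - \<mu>) * Beta (\<mu> * real k - real N + 1) (real N - \<mu>)))"
        using has_bochner_integral_Beta_scaled[of "\<mu> * real k - real N + 1" "real N - \<mu>" x]
          big[of k] False that N
        by (intro has_bochner_integral_mult_right) (simp_all add: algebra_simps)
      moreover have "Gamma (\<mu> * real k + 1 - real N) > 0"
        using big False by (intro Gamma_real_pos) auto
      ultimately show ?thesis
        using False by (simp add: P caputo_coeff_def Beta_def algebra_simps)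
    qed
    have eq: "(\<lambda>t. \<Sum>k\<le>m. b k * P k * (indicator {0<..<x} t *
          (t powr (\<mu> * real k - real N) * (x - t) powr (real N - \<mu> - 1))))
        = (\<lambda>t. indicator {0<..<x} t *\<^sub>R caputo_integrand \<mu> f x t)"
    proof
      fix t
      have "(x - t) powr (real N - \<mu> - 1) = inverse ((x - t) powr (\<mu> + 1 - real N))"
        by (simp add: algebra_simps flip: powr_minus)
      then show "(\<Sum>k\<le>m. b k * P k * (indicator {0<..<x} t *
          (t powr (\<mu> * real k - real N) * (x - t) powr (real N - \<mu> - 1))))
        = indicator {0<..<x} t *\<^sub>R caputo_integrand \<mu> f x t"
        by (auto simp: caputo_integrand_def DN sum_divide_distrib divide_inverse sum_distrib_right
            mult.assoc indicator_def simp flip: N_def)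
    qed
    show ?thesis
      unfolding eq[symmetric] sum_distrib_left by (intro has_bochner_integral_sum *)
  qed
  show "caputo_differentiable \<mu> f"
    using D(2) frac
    by (auto simp: caputo_differentiable_def set_integrable_def has_bochner_integral_iff
        simp flip: N_def)
  assume "x > 0"
  show "caputo \<mu> f x = (\<Sum>k\<le>m. b k * caputo_coeff \<mu> k * x powr (\<mu> * (real k - 1)))"
  proof (cases "\<mu> = real N")
    case True
    have "P k = caputo_coeff \<mu> k" for k
      using True by (cases "k = 0") (auto simp: P0 P caputo_coeff_def algebra_simps)
    then show ?thesis
      using True DN[OF \<open>x > 0\<close>]
      by (simp add: caputo_def algebra_simps flip: N_def)
  next
    case False
    have "Gamma (real N - \<mu>) > 0"
      using False N by (intro Gamma_real_pos) auto
    then show ?thesis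
      using False frac[OF False \<open>x > 0\<close>]
      by (simp add: caputo_def has_bochner_integral_iff set_lebesgue_integral_def flip: N_def)
  qed
qed

section \<open>Growth of the coefficients\<close>

text \<open>For \<open>k > 0\<close> the logarithm of the coefficient is an increment of
  \<open>ln_Gamma\<close> over a step \<mu>, and such increments grow because \<open>Digamma\<close>
  is strictly increasing.\<close>

lemma caputo_coeff_strict_mono:
  assumes "\<mu> > 0"
  shows "strict_mono (caputo_coeff \<mu>)"
proof (rule strict_mono_Suc_iff[THEN iffD2], intro allI)
  fix k
  show "caputo_coeff \<mu> k < caputo_coeff \<mu> (Suc k)"
  proof (cases "k = 0")
    case True
    then show ?thesis using assms by (simp add: caputo_coeff_def Gamma_real_pos)
  next
    case False
    define z where "z = 1 + \<mu> * (real k - 1)"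
    have "z > 0" using False assms by (simp add: z_def add_pos_nonneg)
    have "ln_Gamma (z + \<mu>) - ln_Gamma z < ln_Gamma ((z + \<mu>) + \<mu>) - ln_Gamma (z + \<mu>)"
    proof (rule DERIV_pos_imp_increasing[where f = "\<lambda>t. ln_Gamma (t + \<mu>) - ln_Gamma t"])
      show "z < z + \<mu>" using assms by simp
      fix t assume "z \<le> t"
      then have "((\<lambda>t. ln_Gamma (t + \<mu>) - ln_Gamma t) has_real_derivative Digamma (t + \<mu>) - Digamma t) (at t)"
        using \<open>z > 0\<close> assms by (auto intro!: derivative_eq_intros)
      moreover have "Digamma t < Digamma (t + \<mu>)"
        using \<open>z > 0\<close> \<open>z \<le> t\<close> assms by (intro Digamma_real_strict_mono) auto
      ultimately show "\<exists>D. ((\<lambda>t. ln_Gamma (t + \<mu>) - ln_Gamma t) has_real_derivative D) (at t) \<and> 0 < D"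
        by force
    qed
    then have "Gamma (z + \<mu>) / Gamma z < Gamma (z + \<mu> + \<mu>) / Gamma (z + \<mu>)"
      using \<open>z > 0\<close> assms by (simp add: Gamma_real_pos_exp flip: exp_diff)
    then show ?thesis
      using False by (simp add: caputo_coeff_def z_def algebra_simps)
  qed
qed

section \<open>Recurrences and coefficient algebra\<close>

text \<open>Induction on \<open>n\<close> prepends one term: the tail solves the problem with
  shifted \<open>p\<close> and \<open>q\<close>, hence their generalization, and determines the new
  term at index 0.\<close>

lemma backward_recurrence:
  fixes p q :: "nat \<Rightarrow> real"
  shows "\<exists>a. a n = 1 \<and> (\<forall>k>n. a k = 0) \<and> (\<forall>k<n. a k = p k * a (Suc k) + q k * a (Suc (Suc k)))"
proof (induction n arbitrary: p q)
  case 0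
  show ?case by (rule exI[of _ "\<lambda>k. if k = 0 then 1 else 0"]) simp
next
  case (Suc n)
  obtain a where a: "a n = 1" "\<forall>k>n. a k = 0"
    "\<forall>k<n. a k = p (Suc k) * a (Suc k) + q (Suc k) * a (Suc (Suc k))"
    using Suc[of "\<lambda>k. p (Suc k)" "\<lambda>k. q (Suc k)"] by auto
  show ?case
    using a by (intro exI[of _ "case_nat (p 0 * a 0 + q 0 * a 1) a"])
      (auto simp: less_Suc_eq_0_disj Suc_less_eq2)
qed

text \<open>Multiplication by \<open>X\<close> shifts indices. The two boundary conditions supply
  the missing constant term and remove the overflow at \<open>X ^ Suc n\<close>, so the range of
  summation stays the same.\<close>

lemma mult_shifted_power_sum:
  fixes b :: "nat \<Rightarrow> real"
  assumes "b 0 = 0" "b (Suc n) = 0"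
  shows "X * (\<Sum>k\<le>n. b (Suc k) * X ^ k) = (\<Sum>k\<le>n. b k * X ^ k)"
proof -
  have "X * (\<Sum>k\<le>n. b (Suc k) * X ^ k) = (\<Sum>k\<le>Suc n. b k * X ^ k)"
    using assms(1) by (subst sum.atMost_Suc_shift) (simp add: sum_distrib_left mult_ac)
  then show ?thesis using assms(2) by simp
qed

lemma Beta_eq_Gamma_div_caputo_coeff:
  "Beta (1 + \<mu> * real k) \<mu> = Gamma \<mu> / caputo_coeff \<mu> (Suc k)"
  by (simp add: Beta_def caputo_coeff_def algebra_simps)

text \<open>Translates the Beta quotient of the recursion into Caputo coefficients, to be used both
  at the running index and at \<open>n\<close>. From \<open>k \<ge> 2\<close> on, both shifted
  indices are natural numbers.\<close>

lemma Lambda_quotient_eq_caputo_coeff: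
  assumes "\<mu> > 0" "k \<ge> 2"
  shows "(Gamma \<mu> + s * Beta (1 + \<mu> * (real k - 2)) \<mu>) /
      (Beta (1 + \<mu> * (real k - 1)) \<mu> * Beta (1 + \<mu> * (real k - 2)) \<mu>)
    = caputo_coeff \<mu> k * (caputo_coeff \<mu> (k - 1) + s) / Gamma \<mu>"
proof -
  obtain j where j: "k = Suc (Suc j)"
    using assms(2) by (metis add_2_eq_Suc le_Suc_ex)
  have r: "real k - 2 = real j" "real k - 1 = real (Suc j)"
    by (simp_all add: j)
  have "caputo_coeff \<mu> (Suc i) > 0" for i
    using strict_monoD[OF caputo_coeff_strict_mono[OF assms(1)], of 0 "Suc i"]
    by (simp add: caputo_coeff_def)
  from this[of j] this[of "Suc j"] Gamma_real_pos[OF assms(1)] show ?thesis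
    unfolding r Beta_eq_Gamma_div_caputo_coeff by (simp add: j field_simps)
qed

section \<open>The polynomial solution and its recursion\<close>

theorem corollary3:
  fixes \<mu> \<alpha> \<beta> :: real and n :: nat
  assumes "\<mu> \<in> \<rat>" and "\<mu> > 0" and "\<alpha> > -1" and "\<beta> > -1" and "n \<ge> 2"
  shows "\<exists>(a :: nat \<Rightarrow> real) (y :: real \<Rightarrow> real).
    y = (\<lambda>x. \<Sum>\<nu>\<le>n. a \<nu> * x powr (\<mu> * real \<nu>)) \<and> a n \<noteq> 0 \<and>
    caputo_differentiable \<mu> y \<and> caputo_differentiable \<mu> (caputo \<mu> y) \<and>
    (\<forall>x > 0. (1 - x powr (2 * \<mu>)) * (caputo \<mu> ^^ 2) y x
       + (\<beta> - \<alpha> - (\<alpha> + \<beta> + 2) * x powr \<mu>) * caputo \<mu> y x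
       + jacobi_Lambda \<mu> \<alpha> \<beta> n * y x = 0) \<and>
    a 2 = - ((\<beta> - \<alpha>) * Gamma (1 + \<mu>) / Gamma (1 + 2 * \<mu>)) * a 1
          - jacobi_Lambda \<mu> \<alpha> \<beta> n / Gamma (1 + 2 * \<mu>) * a 0 \<and>
    a 3 = Gamma (1 + \<mu>) * (Gamma (1 + \<mu>) * (\<alpha> + \<beta> + 2) + (\<beta> - \<alpha>)\<^sup>2 - jacobi_Lambda \<mu> \<alpha> \<beta> n)
            / Gamma (1 + 3 * \<mu>) * a 1
          + (\<beta> - \<alpha>) * jacobi_Lambda \<mu> \<alpha> \<beta> n / Gamma (1 + 3 * \<mu>) * a 0 \<and>
    (\<forall>\<nu> \<ge> 2. a (\<nu> + 2) =
       Beta (1 + \<mu> * real \<nu>) \<mu> * Beta (1 + \<mu> * (real \<nu> + 1)) \<mu> / Gamma \<mu> *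
         ((Gamma \<mu> + (\<alpha> + \<beta> + 2) * Beta (1 + \<mu> * (real \<nu> - 2)) \<mu>) /
            (Beta (1 + \<mu> * (real \<nu> - 1)) \<mu> * Beta (1 + \<mu> * (real \<nu> - 2)) \<mu>)
          - (Gamma \<mu> + (\<alpha> + \<beta> + 2) * Beta (1 + \<mu> * (real n - 2)) \<mu>) /
            (Beta (1 + \<mu> * (real n - 1)) \<mu> * Beta (1 + \<mu> * (real n - 2)) \<mu>)) * a \<nu>
       - Beta (1 + \<mu> * (real \<nu> + 1)) \<mu> * (\<beta> - \<alpha>) / Gamma \<mu> * a (\<nu> + 1))"
proof -
  define c where "c = caputo_coeff \<mu>"
  define d where "d = \<beta> - \<alpha>"
  define s where "s = \<alpha> + \<beta> + 2"
  define L where "L = jacobi_Lambda \<mu> \<alpha> \<beta> n"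
  \<comment> \<open>Up to sign, \<open>l k - L\<close> is the diagonal entry of the operator. At
    \<open>k = 0\<close> the truncated \<open>k - 1\<close> is harmless because
    \<open>c 0 = 0\<close>.\<close>
  define l where "l k = c k * (c (k - 1) + s)" for k
  note mono = caputo_coeff_strict_mono[OF \<open>\<mu> > 0\<close>, folded c_def]
  have c0: "c 0 = 0"
    by (simp add: c_def caputo_coeff_def)
  have cpos: "c (Suc k) > 0" for k
    using strict_monoD[OF mono, of 0 "Suc k"] c0 by simp
  have cnonneg: "c k \<ge> 0" for k
    using cpos[of "k - 1"] c0 by (cases k) auto
  have "s > 0"
    using assms by (simp add: s_def)
  \<comment> \<open>Positivity of \<open>s\<close>, which comes from \<alpha>, \<beta> > -1, makes
    the step from \<open>l 0 = 0\<close> to \<open>l 1 = c 1 * s\<close> strict.\<close>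
  have "strict_mono l"
    unfolding strict_mono_Suc_iff
  proof
    fix k
    have "c (k - 1) \<le> c k"
      using mono by (simp add: strict_mono_less_eq)
    then have "l k \<le> c k * (c k + s)"
      unfolding l_def using cnonneg by (intro mult_left_mono) auto
    also have "\<dots> < c (Suc k) * (c k + s)"
      using mono \<open>s > 0\<close> cnonneg[of k] by (intro mult_strict_right_mono) (auto simp: strict_mono_Suc_iff)
    finally show "l k < l (Suc k)"
      by (simp add: l_def)
  qed
  have "Gamma \<mu> > 0"
    using assms by simp
  have "L = Gamma \<mu> * ((Gamma \<mu> + s * Beta (1 + \<mu> * (real n - 2)) \<mu>) /
      (Beta (1 + \<mu> * (real n - 1)) \<mu> * Beta (1 + \<mu> * (real n - 2)) \<mu>))"
    by (simp add: L_def s_def jacobi_Lambda_def)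
  also have "\<dots> = l n"
    unfolding Lambda_quotient_eq_caputo_coeff[OF \<open>\<mu> > 0\<close> \<open>n \<ge> 2\<close>]
    using \<open>Gamma \<mu> > 0\<close> by (simp add: l_def c_def)
  finally have L: "L = l n" .

  obtain a where an: "a n = 1" and a0: "\<forall>k>n. a k = 0"
    and arec: "\<forall>k<n. a k = d * c (Suc k) / (l k - L) * a (Suc k)
      + c (Suc (Suc k)) * c (Suc k) / (l k - L) * a (Suc (Suc k))"
    using backward_recurrence[of n "\<lambda>k. d * c (Suc k) / (l k - L)"
        "\<lambda>k. c (Suc (Suc k)) * c (Suc k) / (l k - L)"] by blast
  \<comment> \<open>This is the vanishing of the coefficient of \<open>X ^ k\<close> in the
    equation. Below \<open>n\<close> it is the construction of \<open>a\<close> with the nonzero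
    divisor cleared; at \<open>n\<close> the factor \<open>l n - L\<close> is zero; above
    \<open>n\<close> every term is zero.\<close>
  have rec: "c (Suc (Suc k)) * c (Suc k) * a (Suc (Suc k)) = (l k - L) * a k - d * c (Suc k) * a (Suc k)" for k
  proof (cases k n rule: linorder_cases)
    case less
    then have "l k - L \<noteq> 0"
      using strict_monoD[OF \<open>strict_mono l\<close>] L by fastforce
    moreover have "(l k - L) * a k = (l k - L) * ((d * c (Suc k) * a (Suc k)
        + c (Suc (Suc k)) * c (Suc k) * a (Suc (Suc k))) / (l k - L))"
      by (simp add: arec[rule_format, OF less] add_divide_distrib)
    ultimately show ?thesis
      by simp
  qed (use a0 L in auto)

  define y where "y = (\<lambda>x. \<Sum>\<nu>\<le>n. a \<nu> * x powr (\<mu> * real \<nu>))"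
  \<comment> \<open>The term with negative exponent has the factor \<open>c 0 = 0\<close>, and a
    zero term is added at the top. The derivative thus regains the form required by
    \<open>caputo_powr_sum\<close>, which can then be applied a second time.\<close>
  have shift: "(\<Sum>k\<le>n. b k * c k * x powr (\<mu> * (real k - 1)))
      = (\<Sum>k\<le>n. b (Suc k) * c (Suc k) * x powr (\<mu> * real k))" if "b (Suc n) = 0" for b x
  proof -
    have "(\<Sum>k\<le>n. b k * c k * x powr (\<mu> * (real k - 1)))
        = (\<Sum>k\<le>Suc n. b k * c k * x powr (\<mu> * (real k - 1)))"
      using that by simp
    then show ?thesis
      by (subst (asm) sum.atMost_Suc_shift) (simp add: c0)
  qed
  have cd1: "caputo_differentiable \<mu> y"
    by (rule caputo_powr_sum(1)[OF \<open>\<mu> > 0\<close>]) (simp add: y_def)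
  have D1: "caputo \<mu> y x = (\<Sum>k\<le>n. a (Suc k) * c (Suc k) * x powr (\<mu> * real k))" if "x > 0" for x
    using caputo_powr_sum(2)[OF \<open>\<mu> > 0\<close> _ that, where f = y and m = n and b = a] shift[where b = a] a0
    by (simp add: y_def flip: c_def)
  have cd2: "caputo_differentiable \<mu> (caputo \<mu> y)"
    by (rule caputo_powr_sum(1)[OF \<open>\<mu> > 0\<close> D1])
  have D2: "caputo \<mu> (caputo \<mu> y) x
      = (\<Sum>k\<le>n. a (Suc (Suc k)) * c (Suc (Suc k)) * c (Suc k) * x powr (\<mu> * real k))" if "x > 0" for x
    using caputo_powr_sum(2)[OF \<open>\<mu> > 0\<close> D1 that] shift[where b = "\<lambda>k. a (Suc k) * c (Suc k)"] a0
    by (simp flip: c_def)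

  have ode: "(1 - x powr (2 * \<mu>)) * (caputo \<mu> ^^ 2) y x + (d - s * x powr \<mu>) * caputo \<mu> y x + L * y x = 0"
    if "x > 0" for x
  proof -
    define X where "X = x powr \<mu>"
    have X: "x powr (\<mu> * real k) = X ^ k" for k
      using that by (simp add: X_def powr_powr[symmetric] powr_realpow)
    have yx: "y x = (\<Sum>k\<le>n. a k * X ^ k)"
      by (simp add: y_def X)
    \<comment> \<open>Coefficient of \<open>X ^ k\<close> in \<open>X\<^sup>2\<close> times the
      second derivative; \<open>e 0\<close> and \<open>e 1\<close> vanish through
      \<open>c 0 = 0\<close>, so two shifts are possible.\<close>
    define e where "e k = a k * c k * c (k - 1)" for k
    have X1: "X * caputo \<mu> y x = (\<Sum>k\<le>n. a k * c k * X ^ k)"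
      using mult_shifted_power_sum[of "\<lambda>k. a k * c k" n X] a0 c0
      by (simp add: D1[OF that] X)
    have "X\<^sup>2 * caputo \<mu> (caputo \<mu> y) x = X * (X * (\<Sum>k\<le>n. e (Suc (Suc k)) * X ^ k))"
      by (simp add: D2[OF that] X power2_eq_square e_def)
    also have "X * (\<Sum>k\<le>n. e (Suc (Suc k)) * X ^ k) = (\<Sum>k\<le>n. e (Suc k) * X ^ k)"
      using a0 c0 by (intro mult_shifted_power_sum[of "\<lambda>k. e (Suc k)"]) (auto simp: e_def)
    also have "X * \<dots> = (\<Sum>k\<le>n. e k * X ^ k)"
      using a0 c0 by (intro mult_shifted_power_sum) (auto simp: e_def)
    finally have X2: "X\<^sup>2 * caputo \<mu> (caputo \<mu> y) x = (\<Sum>k\<le>n. e k * X ^ k)" .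
    have "x powr (2 * \<mu>) = X\<^sup>2"
      using X[of 2] by (simp add: mult.commute)
    then have "(1 - x powr (2 * \<mu>)) * (caputo \<mu> ^^ 2) y x + (d - s * x powr \<mu>) * caputo \<mu> y x + L * y x
      = caputo \<mu> (caputo \<mu> y) x - X\<^sup>2 * caputo \<mu> (caputo \<mu> y) x
        + d * caputo \<mu> y x - s * (X * caputo \<mu> y x) + L * y x"
      by (simp add: eval_nat_numeral X_def algebra_simps)
    \<comment> \<open>Each coefficient is the difference of the two sides of
      \<open>rec\<close>.\<close>
    also have "\<dots> = (\<Sum>k\<le>n. (c (Suc (Suc k)) * c (Suc k) * a (Suc (Suc k))
        - ((l k - L) * a k - d * c (Suc k) * a (Suc k))) * X ^ k)"
      unfolding X1 X2 unfolding D1[OF that] D2[OF that] X yx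
      by (simp add: sum_distrib_left algebra_simps e_def l_def
          flip: sum.distrib sum_subtractf)
    also have "\<dots> = 0"
      by (simp add: rec)
    finally show ?thesis .
  qed

  \<comment> \<open>Products of consecutive coefficients starting at \<open>c 1\<close> telescope to
    a single Gamma value, since \<open>Gamma 1 = 1\<close>.\<close>
  have c1: "c 1 = Gamma (1 + \<mu>)" and c21: "c 2 * c 1 = Gamma (1 + 2 * \<mu>)"
    and c321: "c 3 * c 2 * c 1 = Gamma (1 + 3 * \<mu>)"
  proof -
    have "Gamma (1 + 2 * \<mu>) \<noteq> 0" "Gamma (1 + \<mu>) \<noteq> 0"
      using \<open>\<mu> > 0\<close> by (intro less_imp_neq[THEN not_sym] Gamma_real_pos; simp)+
    then show "c 1 = Gamma (1 + \<mu>)" "c 2 * c 1 = Gamma (1 + 2 * \<mu>)"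
      "c 3 * c 2 * c 1 = Gamma (1 + 3 * \<mu>)"
      by (simp_all add: c_def caputo_coeff_def mult.commute)
  qed
  have cne: "c 1 \<noteq> 0" "c 2 \<noteq> 0" "c 3 \<noteq> 0"
    using cpos[of 0] cpos[of 1] cpos[of 2] by (auto simp: eval_nat_numeral)
  have r0: "c 2 * c 1 * a 2 = - L * a 0 - d * c 1 * a 1"
    using rec[of 0] by (simp add: l_def c0 eval_nat_numeral)
  have r1: "c 3 * c 2 * a 3 = (s * c 1 - L) * a 1 - d * c 2 * a 2"
    using rec[of 1] by (simp add: l_def c0 eval_nat_numeral mult.commute)
  have a2: "a 2 = - (d * Gamma (1 + \<mu>) / Gamma (1 + 2 * \<mu>)) * a 1 - L / Gamma (1 + 2 * \<mu>) * a 0"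
  proof -
    have "a 2 = (- L * a 0 - d * c 1 * a 1) / (c 2 * c 1)"
      using r0 cne by (simp add: eq_divide_eq mult.commute)
    then show ?thesis
      unfolding c21 unfolding c1 by (simp add: diff_divide_distrib)
  qed
  \<comment> \<open>The factor \<open>c 1\<close> produces the product
    \<open>c 2 * c 1 * a 2\<close>, so that \<open>r0\<close> eliminates \<open>a 2\<close> in
    favour of the initial values.\<close>
  have "c 3 * c 2 * c 1 * a 3 = c 1 * (s * c 1 - L) * a 1 - d * (c 2 * c 1 * a 2)"
    using arg_cong[OF r1, of "(*) (c 1)"] by (simp add: algebra_simps)
  then have "c 3 * c 2 * c 1 * a 3 = c 1 * (c 1 * s + d\<^sup>2 - L) * a 1 + d * L * a 0"
    unfolding r0 by (simp add: algebra_simps power2_eq_square)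
  then have "a 3 = (c 1 * (c 1 * s + d\<^sup>2 - L) * a 1 + d * L * a 0) / (c 3 * c 2 * c 1)"
    using cne by (simp add: eq_divide_eq mult.commute)
  then have a3: "a 3 = Gamma (1 + \<mu>) * (Gamma (1 + \<mu>) * s + d\<^sup>2 - L) / Gamma (1 + 3 * \<mu>) * a 1
      + d * L / Gamma (1 + 3 * \<mu>) * a 0"
    unfolding c321 unfolding c1 by (simp add: add_divide_distrib)
  have anu: "a (k + 2) =
       Beta (1 + \<mu> * real k) \<mu> * Beta (1 + \<mu> * (real k + 1)) \<mu> / Gamma \<mu> *
         ((Gamma \<mu> + s * Beta (1 + \<mu> * (real k - 2)) \<mu>) /
            (Beta (1 + \<mu> * (real k - 1)) \<mu> * Beta (1 + \<mu> * (real k - 2)) \<mu>)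
          - (Gamma \<mu> + s * Beta (1 + \<mu> * (real n - 2)) \<mu>) /
            (Beta (1 + \<mu> * (real n - 1)) \<mu> * Beta (1 + \<mu> * (real n - 2)) \<mu>)) * a k
       - Beta (1 + \<mu> * (real k + 1)) \<mu> * d / Gamma \<mu> * a (k + 1)" if "k \<ge> 2" for k
  proof -
    have B: "Beta (1 + \<mu> * real k) \<mu> = Gamma \<mu> / c (Suc k)"
      "Beta (1 + \<mu> * (real k + 1)) \<mu> = Gamma \<mu> / c (Suc (Suc k))"
      using Beta_eq_Gamma_div_caputo_coeff[of \<mu> k] Beta_eq_Gamma_div_caputo_coeff[of \<mu> "Suc k"]
      by (simp_all add: c_def add.commute)
    have "a (Suc (Suc k)) = ((l k - L) * a k - d * c (Suc k) * a (Suc k)) / (c (Suc (Suc k)) * c (Suc k))"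
      using rec[of k] cpos[of k] cpos[of "Suc k"] by (simp add: eq_divide_eq mult.commute)
    \<comment> \<open>The cancelling factors \<open>Gamma \<mu>\<close> are inserted to match the
      Beta values in \<open>B\<close> and the quotients by \<open>Gamma \<mu>\<close> from
      \<open>Lambda_quotient_eq_caputo_coeff\<close>.\<close>
    also have "\<dots> = Gamma \<mu> / c (Suc k) * (Gamma \<mu> / c (Suc (Suc k))) / Gamma \<mu>
        * (l k / Gamma \<mu> - L / Gamma \<mu>) * a k
        - Gamma \<mu> / c (Suc (Suc k)) * d / Gamma \<mu> * a (Suc k)"
      using cpos[of k] cpos[of "Suc k"] \<open>Gamma \<mu> > 0\<close> by (simp add: field_simps)
    finally show ?thesis
      unfolding Lambda_quotient_eq_caputo_coeff[OF \<open>\<mu> > 0\<close> that] Lambda_quotient_eq_caputo_coeff[OF \<open>\<mu> > 0\<close> \<open>n \<ge> 2\<close>] B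
      by (simp add: L l_def c_def)
  qed
  show ?thesis
    using cd1 cd2 ode a2 a3 anu an
    unfolding d_def s_def L_def
    by (intro exI[of _ a] exI[of _ y]) (simp add: y_def)
qed

end
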